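(* Let $\mathcal{C}$ be a finite acyclic category. There exist an alphabet $\Sigma$ and a weak embedding $F\colon \mathcal{C}\to \mathrm{Word}(\Sigma)$ if and only if $\mathcal{C}$ is monic and left locally totally ordered.
   Context: A finite category has finitely many objects and morphisms. A small category $\mathcal{C}$ is acyclic if for all distinct objects $c\neq d$, $\mathrm{Hom}(c,d)\neq\varnothing$ implies $\mathrm{Hom}(d,c)=\varnothing$, and $\mathrm{Hom}(c,c)=\{\mathrm{id}_c\}$ for every object $c$. A functor is a weak embedding if it is faithful and injective on objects. An alphabet is a set $\Sigma$. A word of length $n$ over $\Sigma$ is a function $w\colon[n]\to\Sigma$, where $[n]=\{1,\dots,n\}$ and $[0]=\varnothing$. For words $w\colon[n]\to\Sigma$ and $w'\colon[m]\to\Sigma$, a subword inclusion $w'\to w$ is an injective order-preserving map $f\colon[m]\to[n]$ such that $w\circ f=w'$. $\mathrm{Word}(\Sigma)$ is the category whose objects are all words over $\Sigma$ and whose morphisms are subword inclusions. A category is monic if every morphism is a monomorphism ($f\circ g=f\circ h$ implies $g=h$). A small category is left locally totally ordered if each hom-set $\mathrm{Hom}(c,d)$ can be equipped with a total order such that, for all objects $c,d,e$, every $g\colon d\to e$ and all $f_1,f_2\in\mathrm{Hom}(c,d)$, $f_1<f_2$ implies $g\circ f_1<g\circ f_2$. *)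

theory Defs
  imports Main "HOL-Library.FuncSet" "HOL-Library.Infinite_Typeclass"
begin

section \<open>Small categories\<close>

record ('o, 'm) category_data =
  Obj :: "'o set"
  Mor :: "'m set"
  Dom :: "'m \<Rightarrow> 'o"
  Cod :: "'m \<Rightarrow> 'o"
  Ident :: "'o \<Rightarrow> 'm"
  Comp :: "'m \<Rightarrow> 'm \<Rightarrow> 'm"  (infixl "\<cdot>\<index>" 55)

definition Hom :: "('o, 'm, 'z) category_data_scheme \<Rightarrow> 'o \<Rightarrow> 'o \<Rightarrow> 'm set" where
  "Hom C c d = {f \<in> Mor C. Dom C f = c \<and> Cod C f = d}"

text \<open>\<open>g \<cdot> f\<close> is ``\<open>f\<close> first, then \<open>g\<close>''; its value is unconstrained unless the codomain
  of \<open>f\<close> is the domain of \<open>g\<close>.\<close>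

locale category =
  fixes C :: "('o, 'm, 'z) category_data_scheme" (structure)
  assumes dom_in_Obj: "f \<in> Mor C \<Longrightarrow> Dom C f \<in> Obj C"
    and cod_in_Obj: "f \<in> Mor C \<Longrightarrow> Cod C f \<in> Obj C"
    and ident_in_Hom: "c \<in> Obj C \<Longrightarrow> Ident C c \<in> Hom C c c"
    and comp_in_Hom: "\<lbrakk>f \<in> Hom C c d; g \<in> Hom C d e\<rbrakk> \<Longrightarrow> g \<cdot> f \<in> Hom C c e"
    and comp_ident_right: "f \<in> Hom C c d \<Longrightarrow> f \<cdot> Ident C c = f"
    and comp_ident_left: "f \<in> Hom C c d \<Longrightarrow> Ident C d \<cdot> f = f"
    and comp_assoc: "\<lbrakk>f \<in> Hom C a b; g \<in> Hom C b c; h \<in> Hom C c d\<rbrakk>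
      \<Longrightarrow> h \<cdot> (g \<cdot> f) = (h \<cdot> g) \<cdot> f"

locale finite_category = category +
  assumes finite_Obj: "finite (Obj C)"
    and finite_Mor: "finite (Mor C)"

definition acyclic_category :: "('o, 'm, 'z) category_data_scheme \<Rightarrow> bool" where
  "acyclic_category C \<longleftrightarrow>
    (\<forall>c \<in> Obj C. \<forall>d \<in> Obj C. c \<noteq> d \<longrightarrow> Hom C c d \<noteq> {} \<longrightarrow> Hom C d c = {}) \<and>
    (\<forall>c \<in> Obj C. Hom C c c = {Ident C c})"

definition monomorphism :: "('o, 'm, 'z) category_data_scheme \<Rightarrow> 'm \<Rightarrow> bool" where
  "monomorphism C f \<longleftrightarrow> f \<in> Mor C \<and>
    (\<forall>b \<in> Obj C. \<forall>g \<in> Hom C b (Dom C f). \<forall>h \<in> Hom C b (Dom C f).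
      f \<cdot>\<^bsub>C\<^esub> g = f \<cdot>\<^bsub>C\<^esub> h \<longrightarrow> g = h)"

definition monic_category :: "('o, 'm, 'z) category_data_scheme \<Rightarrow> bool" where
  "monic_category C \<longleftrightarrow> (\<forall>f \<in> Mor C. monomorphism C f)"

text \<open>The orders \<open>r c d\<close> are reflexive, so the strict order is \<open>r c d - Id\<close>.\<close>

definition left_locally_totally_ordered :: "('o, 'm, 'z) category_data_scheme \<Rightarrow> bool" where
  "left_locally_totally_ordered C \<longleftrightarrow>
    (\<exists>r :: 'o \<Rightarrow> 'o \<Rightarrow> 'm rel.
      (\<forall>c \<in> Obj C. \<forall>d \<in> Obj C. linear_order_on (Hom C c d) (r c d)) \<and>
      (\<forall>c \<in> Obj C. \<forall>d \<in> Obj C. \<forall>e \<in> Obj C.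
        \<forall>g \<in> Hom C d e. \<forall>f\<^sub>1 \<in> Hom C c d. \<forall>f\<^sub>2 \<in> Hom C c d.
          (f\<^sub>1, f\<^sub>2) \<in> r c d - Id \<longrightarrow> (g \<cdot>\<^bsub>C\<^esub> f\<^sub>1, g \<cdot>\<^bsub>C\<^esub> f\<^sub>2) \<in> r c e - Id))"


section \<open>Functors and weak embeddings\<close>

locale category_functor = C: category C + D: category D
  for C :: "('o, 'm, 'z) category_data_scheme"
    and D :: "('p, 'n, 'y) category_data_scheme" +
  fixes F\<^sub>o :: "'o \<Rightarrow> 'p" and F\<^sub>m :: "'m \<Rightarrow> 'n"
  assumes map_Obj: "c \<in> Obj C \<Longrightarrow> F\<^sub>o c \<in> Obj D"
    and map_Hom: "f \<in> Hom C c d \<Longrightarrow> F\<^sub>m f \<in> Hom D (F\<^sub>o c) (F\<^sub>o d)"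
    and map_ident: "c \<in> Obj C \<Longrightarrow> F\<^sub>m (Ident C c) = Ident D (F\<^sub>o c)"
    and map_comp: "\<lbrakk>f \<in> Hom C c d; g \<in> Hom C d e\<rbrakk>
      \<Longrightarrow> F\<^sub>m (g \<cdot>\<^bsub>C\<^esub> f) = F\<^sub>m g \<cdot>\<^bsub>D\<^esub> F\<^sub>m f"

locale weak_embedding = category_functor +
  assumes faithful: "\<lbrakk>c \<in> Obj C; d \<in> Obj C\<rbrakk> \<Longrightarrow> inj_on F\<^sub>m (Hom C c d)"
    and inj_on_Obj: "inj_on F\<^sub>o (Obj C)"


section \<open>The category of words\<close>

text \<open>Words over \<open>\<Sigma>\<close> are lists with entries in \<open>\<Sigma>\<close>; following the list library, the positions of
  a word of length \<open>n\<close> are \<open>0, \<dots>, n - 1\<close> rather than \<open>1, \<dots>, n\<close>. Maps between sets of positions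
  are extensional functions, so that equal maps are equal as HOL functions.\<close>

definition subword_inclusion :: "'s list \<Rightarrow> 's list \<Rightarrow> (nat \<Rightarrow> nat) \<Rightarrow> bool" where
  "subword_inclusion w' w f \<longleftrightarrow>
    f \<in> {..<length w'} \<rightarrow>\<^sub>E {..<length w} \<and>
    inj_on f {..<length w'} \<and> mono_on {..<length w'} f \<and>
    (\<forall>i < length w'. w ! f i = w' ! i)"

text \<open>A morphism is a triple (source word, target word, map of positions).\<close>

definition Word :: "'s set \<Rightarrow> ('s list, 's list \<times> 's list \<times> (nat \<Rightarrow> nat)) category_data" where
  "Word \<Sigma> =
    \<lparr>Obj = lists \<Sigma>,
     Mor = {(w', w, f). w' \<in> lists \<Sigma> \<and> w \<in> lists \<Sigma> \<and> subword_inclusion w' w f},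
     Dom = (\<lambda>(w', w, f). w'),
     Cod = (\<lambda>(w', w, f). w),
     Ident = (\<lambda>w. (w, w, \<lambda>i\<in>{..<length w}. i)),
     Comp = (\<lambda>(v, w, g) (u, v', f). (u, w, compose {..<length u} g f))\<rparr>"

lemma Word_simps [simp]:
  "Obj (Word \<Sigma>) = lists \<Sigma>"
  "Ident (Word \<Sigma>) w = (w, w, \<lambda>i\<in>{..<length w}. i)"
  "(v, w, g) \<cdot>\<^bsub>Word \<Sigma>\<^esub> (u, v', f) = (u, w, compose {..<length u} g f)"
  by (simp_all add: Word_def)

lemma Hom_Word:
  "Hom (Word \<Sigma>) u v =
    {(u, v, f) | f. u \<in> lists \<Sigma> \<and> v \<in> lists \<Sigma> \<and> subword_inclusion u v f}"
  by (auto simp: Hom_def Word_def)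

lemma subword_inclusion_ident:
  "subword_inclusion w w (\<lambda>i\<in>{..<length w}. i)"
  by (auto simp: subword_inclusion_def inj_on_def mono_on_def)

lemma subword_inclusion_compose:
  assumes f: "subword_inclusion u v f" and g: "subword_inclusion v w g"
  shows "subword_inclusion u w (compose {..<length u} g f)"
proof -
  have f_lt: "f i < length v" if "i < length u" for i
    using f that by (auto simp: subword_inclusion_def)
  have g_lt: "g i < length w" if "i < length v" for i
    using g that by (auto simp: subword_inclusion_def)
  have "inj_on (compose {..<length u} g f) {..<length u}"
    using f g f_lt by (simp add: subword_inclusion_def inj_on_def compose_def)
  moreover have "mono_on {..<length u} (compose {..<length u} g f)"
    using f g f_lt by (auto simp: subword_inclusion_def mono_on_def compose_def)
  moreover have "\<forall>i < length u. w ! compose {..<length u} g f i = u ! i"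
    using f g f_lt by (simp add: subword_inclusion_def compose_def)
  ultimately show ?thesis
    using f_lt g_lt by (auto simp: subword_inclusion_def compose_def)
qed

lemma category_Word: "category (Word \<Sigma>)"
proof
  fix f c d assume f: "f \<in> Hom (Word \<Sigma>) c d"
  show "f \<cdot>\<^bsub>Word \<Sigma>\<^esub> Ident (Word \<Sigma>) c = f" "Ident (Word \<Sigma>) d \<cdot>\<^bsub>Word \<Sigma>\<^esub> f = f"
    using f by (auto simp: Hom_Word subword_inclusion_def compose_def fun_eq_iff
        PiE_def extensional_def Pi_def)
next
  fix a b c d f g h
  assume "f \<in> Hom (Word \<Sigma>) a b" "g \<in> Hom (Word \<Sigma>) b c" "h \<in> Hom (Word \<Sigma>) c d"
  then show "h \<cdot>\<^bsub>Word \<Sigma>\<^esub> (g \<cdot>\<^bsub>Word \<Sigma>\<^esub> f) = (h \<cdot>\<^bsub>Word \<Sigma>\<^esub> g) \<cdot>\<^bsub>Word \<Sigma>\<^esub> f"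
    by (auto simp: Hom_Word subword_inclusion_def compose_def fun_eq_iff)
next
  fix c assume "c \<in> Obj (Word \<Sigma>)"
  then show "Ident (Word \<Sigma>) c \<in> Hom (Word \<Sigma>) c c"
    by (auto simp: Hom_Word intro: subword_inclusion_ident)
next
  fix f c d g e
  assume "f \<in> Hom (Word \<Sigma>) c d" "g \<in> Hom (Word \<Sigma>) d e"
  then show "g \<cdot>\<^bsub>Word \<Sigma>\<^esub> f \<in> Hom (Word \<Sigma>) c e"
    by (auto simp: Hom_Word intro: subword_inclusion_compose)
qed (auto simp: Word_def)

end

theory Submission
  imports Defs "HOL-Library.Fun_Lexorder"
begin

text \<open>If the hom-sets are ordered, a word \<open>F d\<close> is obtained by a Yoneda construction: its
  positions are all morphisms into \<open>d\<close>, the letter at \<open>f\<close> is the domain of \<open>f\<close>, and \<open>F g\<close> is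
  composition with \<open>g\<close>. The positions are ordered first by domain and then by the given orders on
  the hom-sets. Faithfulness is seen at the position \<open>id\<close>, and by acyclicity the set of letters of
  \<open>F d\<close> determines \<open>d\<close>. For the direct implication, the orders on the hom-sets are pulled back from
  the lexicographic order on position maps.\<close>

section \<open>Ranks in a finite linear order\<close>

lemma finite_linear_order_on_rank:
  assumes "finite A" "linear_order_on A r"
  obtains p :: "'a \<Rightarrow> nat" where "bij_betw p A {..<card A}"
    and "\<And>x y. \<lbrakk>x \<in> A; y \<in> A\<rbrakk> \<Longrightarrow> p x < p y \<longleftrightarrow> (x, y) \<in> r - Id"
proof -
  have tr: "trans r" and an: "antisym r" and tot: "total_on A r"
    using assms(2) by (auto simp: order_on_defs)
  \<comment> \<open>The rank counts strict predecessors only, so ranks start at 0 like list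
    positions.\<close>
  define p where "p x = card {y \<in> A. (y, x) \<in> r - Id}" for x
  have less: "p x < p y" if "x \<in> A" "y \<in> A" "(x, y) \<in> r - Id" for x y
    unfolding p_def
  proof (rule psubset_card_mono)
    \<comment> \<open>The inclusion is proper because \<open>x\<close> precedes \<open>y\<close>
      strictly but not itself.\<close>
    show "{z \<in> A. (z, x) \<in> r - Id} \<subset> {z \<in> A. (z, y) \<in> r - Id}"
      using that tr an by (auto dest: transD antisymD)
  qed (use assms(1) in simp)
  have iff: "p x < p y \<longleftrightarrow> (x, y) \<in> r - Id" if "x \<in> A" "y \<in> A" for x y
    using less[OF that] less[OF that(2,1)] that tot by (fastforce simp: total_on_def)
  have inj: "inj_on p A"
  proof (rule inj_onI)
    fix x y assume "x \<in> A" "y \<in> A" "p x = p y"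
    then show "x = y"
      using less[of x y] less[of y x] tot by (auto simp: total_on_def)
  qed
  have "p ` A \<subseteq> {..<card A}"
    using assms(1) by (auto simp: p_def intro!: psubset_card_mono)
  then have "p ` A = {..<card A}"
    using inj by (intro card_subset_eq) (auto simp: card_image)
  with inj iff show thesis
    by (intro that[of p]) (auto simp: bij_betw_def)
qed

section \<open>Subword inclusions and the lexicographic order\<close>

lemma subword_inclusion_less:
  assumes "subword_inclusion u v f" "i < j" "j < length u"
  shows "f i < f j"
proof -
  have "f i \<le> f j" and "f i \<noteq> f j"
    using assms unfolding subword_inclusion_def mono_on_def inj_on_def
    by (force, metis lessThan_iff less_trans less_irrefl)
  then show ?thesis by simp
qed

lemma subword_inclusionI:
  assumes "f \<in> {..<length u} \<rightarrow>\<^sub>E {..<length v}"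
    and "\<And>i j. \<lbrakk>i < j; j < length u\<rbrakk> \<Longrightarrow> f i < f j"
    and "\<And>i. i < length u \<Longrightarrow> v ! f i = u ! i"
  shows "subword_inclusion u v f"
proof -
  have "strict_mono_on {..<length u} f"
    using assms(2) by (auto simp: strict_mono_on_def)
  then show ?thesis
    using assms by (auto simp: subword_inclusion_def strict_mono_on_imp_inj_on
        intro: strict_mono_on_imp_mono_on)
qed

lemma subword_inclusion_ge:
  "\<lbrakk>subword_inclusion u v f; length u \<le> i\<rbrakk> \<Longrightarrow> f i = undefined"
  by (auto simp: subword_inclusion_def PiE_def extensional_def)

text \<open>Both maps are \<open>undefined\<close> beyond \<open>u\<close>, so they disagree at
  finitely many points only, which is what trichotomy of \<open>less_fun\<close> asks for.\<close>

lemma subword_inclusion_less_fun_cases: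
  assumes "subword_inclusion u v f" "subword_inclusion u v f'"
  shows "less_fun f f' \<or> f = f' \<or> less_fun f' f"
proof (rule less_fun_trichotomy)
  have "{k. f k \<noteq> f' k} \<subseteq> {..<length u}"
    using subword_inclusion_ge[OF assms(1)] subword_inclusion_ge[OF assms(2)]
    by (force simp: not_le[symmetric])
  then show "finite {k. f k \<noteq> f' k}"
    by (rule finite_subset) simp
qed

text \<open>The first point of disagreement survives: earlier values stay equal, and
  \<open>g\<close> is strictly increasing at that point.\<close>

lemma less_fun_compose:
  assumes f: "subword_inclusion u v f" "subword_inclusion u v f'"
    and g: "subword_inclusion v w g" and "less_fun f f'"
  shows "less_fun (compose {..<length u} g f) (compose {..<length u} g f')"
proof -
  obtain k where k: "f k < f' k" "\<And>i. i < k \<Longrightarrow> f i = f' i"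
    using less_funE[OF assms(4)] by metis
  \<comment> \<open>Beyond \<open>u\<close> both maps have the same default value, so a strict
    inequality cannot occur there.\<close>
  have "k < length u"
    using k(1) subword_inclusion_ge[OF f(1)] subword_inclusion_ge[OF f(2)]
    by (metis less_irrefl not_le)
  moreover from this have "f' k < length v"
    using f(2) by (auto simp: subword_inclusion_def)
  ultimately show ?thesis
    using k subword_inclusion_less[OF g, of "f k" "f' k"]
    by (intro less_funI exI[of _ k]) (auto simp: compose_def)
qed

section \<open>From weak embeddings to ordered hom-sets and monicity\<close>

lemma monic_of_left_locally_totally_ordered:
  assumes "category C" and "left_locally_totally_ordered C"
  shows "monic_category C"
proof -
  interpret category C by fact
  obtain r where lin: "\<And>c d. \<lbrakk>c \<in> Obj C; d \<in> Obj C\<rbrakk> \<Longrightarrow> linear_order_on (Hom C c d) (r c d)"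
    and left: "\<And>c d e f f' g. \<lbrakk>c \<in> Obj C; d \<in> Obj C; e \<in> Obj C; g \<in> Hom C d e;
      f \<in> Hom C c d; f' \<in> Hom C c d; (f, f') \<in> r c d - Id\<rbrakk>
      \<Longrightarrow> (g \<cdot>\<^bsub>C\<^esub> f, g \<cdot>\<^bsub>C\<^esub> f') \<in> r c e - Id"
    using assms(2) unfolding left_locally_totally_ordered_def by blast
  have "f = f'" if g: "g \<in> Mor C" and c: "c \<in> Obj C"
    and f: "f \<in> Hom C c (Dom C g)" "f' \<in> Hom C c (Dom C g)"
    and eq: "g \<cdot>\<^bsub>C\<^esub> f = g \<cdot>\<^bsub>C\<^esub> f'" for g c f f'
  proof (rule ccontr)
    assume "f \<noteq> f'"
    \<comment> \<open>Distinct parallel morphisms are comparable, and a strict comparison remains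
      strict after composition with \<open>g\<close>; this contradicts the equality of the
      composites.\<close>
    then have "(f, f') \<in> r c (Dom C g) - Id \<or> (f', f) \<in> r c (Dom C g) - Id"
      using lin[OF c dom_in_Obj[OF g]] f by (auto simp: order_on_defs total_on_def)
    moreover have "g \<in> Hom C (Dom C g) (Cod C g)"
      using g by (simp add: Hom_def)
    ultimately show False
      using left[OF c dom_in_Obj[OF g] cod_in_Obj[OF g]] f eq by (metis DiffE IdI)
  qed
  then show ?thesis
    by (auto simp: monic_category_def monomorphism_def)
qed

lemma left_locally_totally_ordered_of_weak_embedding:
  assumes "weak_embedding C (Word \<Sigma>) F\<^sub>o F\<^sub>m"
  shows "left_locally_totally_ordered C"
proof -
  interpret weak_embedding C "Word \<Sigma>" F\<^sub>o F\<^sub>m by fact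
  \<comment> \<open>The position map of \<open>F\<^sub>m f\<close>; the other two components are
    fixed by the domain and codomain of \<open>f\<close>.\<close>
  define q where "q f = snd (snd (F\<^sub>m f))" for f
  have F: "F\<^sub>m f = (F\<^sub>o c, F\<^sub>o d, q f)" and q: "subword_inclusion (F\<^sub>o c) (F\<^sub>o d) (q f)"
    if "f \<in> Hom C c d" for c d f
    using map_Hom[OF that] by (auto simp: Hom_Word q_def)
  define r where "r c d = {(f, f'). f \<in> Hom C c d \<and> f' \<in> Hom C c d \<and>
    (f = f' \<or> less_fun (q f) (q f'))}" for c d
  have "linear_order_on (Hom C c d) (r c d)" if "c \<in> Obj C" "d \<in> Obj C" for c d
  proof -
    \<comment> \<open>Faithfulness enters here: distinct parallel morphisms have distinct position
      maps, so \<open>less_fun\<close> compares them and the order is total.\<close>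
    have "f = f'" if f: "f \<in> Hom C c d" "f' \<in> Hom C c d" "q f = q f'" for f f'
      using f F[OF f(1)] F[OF f(2)] inj_onD[OF faithful[OF \<open>c \<in> Obj C\<close> \<open>d \<in> Obj C\<close>]]
      by auto
    then have "total_on (Hom C c d) (r c d)"
      using subword_inclusion_less_fun_cases[OF q q, of _ c d]
      unfolding total_on_def r_def by blast
    moreover have "trans (r c d)" "antisym (r c d)"
      by (auto simp: r_def trans_def antisym_def intro: less_fun_trans dest: less_fun_asym)
    ultimately show ?thesis
      by (auto simp: order_on_defs refl_on_def r_def)
  qed
  moreover have "(g \<cdot>\<^bsub>C\<^esub> f, g \<cdot>\<^bsub>C\<^esub> f') \<in> r c e - Id"
    if g: "g \<in> Hom C d e" and f: "f \<in> Hom C c d" and f': "f' \<in> Hom C c d"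
      and "(f, f') \<in> r c d - Id" for c d e g f f'
  proof -
    \<comment> \<open>By functoriality, left composition with \<open>g\<close> becomes composition
      of position maps, to which \<open>less_fun_compose\<close> applies.\<close>
    have q_comp: "q (g \<cdot>\<^bsub>C\<^esub> h) = compose {..<length (F\<^sub>o c)} (q g) (q h)" if "h \<in> Hom C c d" for h
      using map_comp[OF that g] F[OF that] F[OF g] F[OF C.comp_in_Hom[OF that g]] by simp
    have "less_fun (q (g \<cdot>\<^bsub>C\<^esub> f)) (q (g \<cdot>\<^bsub>C\<^esub> f'))"
      unfolding q_comp[OF f] q_comp[OF f']
      using that by (intro less_fun_compose[OF q[OF f] q[OF f'] q[OF g]]) (auto simp: r_def)
    then show ?thesis
      using C.comp_in_Hom[OF f g] C.comp_in_Hom[OF f' g] by (auto simp: r_def less_fun_irrefl)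
  qed
  ultimately show ?thesis
    unfolding left_locally_totally_ordered_def by (intro exI[of _ r] conjI ballI impI)
qed

section \<open>The ordered set of all morphisms into an object\<close>

context finite_category
begin

text \<open>The disjoint union of the hom-sets into \<open>d\<close>, or the objects of the slice
  category over \<open>d\<close>. In this context \<open>'a\<close> is the type of objects and
  \<open>'b\<close> that of morphisms.\<close>

definition mor_into :: "'a \<Rightarrow> 'b set" where
  "mor_into d = {f \<in> Mor C. Cod C f = d}"

lemma finite_mor_into: "finite (mor_into d)"
  using finite_Mor by (simp add: mor_into_def)

lemma mor_into_iff: "f \<in> mor_into d \<longleftrightarrow> f \<in> Hom C (Dom C f) d"
  by (simp add: mor_into_def Hom_def)

lemma comp_in_mor_into:
  assumes "f \<in> mor_into d" "g \<in> Hom C d e"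
  shows "g \<cdot> f \<in> mor_into e" "Dom C (g \<cdot> f) = Dom C f"
  using comp_in_Hom[OF assms(1)[unfolded mor_into_iff] assms(2)]
  by (auto simp: mor_into_def Hom_def)

text \<open>An ordinal sum: the blocks \<open>Hom C c d\<close> are arranged by \<open>idx\<close>,
  which separates domains, and each block carries its own order.\<close>

lemma mor_into_order:
  assumes lin: "\<And>c. c \<in> Obj C \<Longrightarrow> linear_order_on (Hom C c d) (r c d)"
    and idx: "inj_on idx (Obj C)"
  shows "linear_order_on (mor_into d) {(f, f'). f \<in> mor_into d \<and> f' \<in> mor_into d \<and>
    (idx (Dom C f) < (idx (Dom C f') :: nat) \<or> Dom C f = Dom C f' \<and> (f, f') \<in> r (Dom C f) d)}"
    (is "linear_order_on _ ?L")
proof -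
  have Dom: "Dom C f \<in> Obj C" if "f \<in> mor_into d" for f
    using that dom_in_Obj by (simp add: mor_into_def)
  have r: "refl_on (Hom C c d) (r c d)" "trans (r c d)" "antisym (r c d)"
    "total_on (Hom C c d) (r c d)" if "c \<in> Obj C" for c
    using lin[OF that] by (auto simp: order_on_defs)
  have "refl_on (mor_into d) ?L"
    using r(1)[OF Dom] by (auto simp: refl_on_def mor_into_iff)
  moreover have "trans ?L"
    by (rule transI) (auto intro: transD[OF r(2)[OF Dom]])
  moreover have "antisym ?L"
    by (rule antisymI) (auto intro: antisymD[OF r(3)[OF Dom]])
  moreover have "total_on (mor_into d) ?L"
  proof (rule total_onI)
    fix f f' assume f: "f \<in> mor_into d" "f' \<in> mor_into d" and "f \<noteq> f'"
    show "(f, f') \<in> ?L \<or> (f', f) \<in> ?L"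
    proof (cases "Dom C f = Dom C f'")
      case True
      with f \<open>f \<noteq> f'\<close> r(4)[OF Dom[OF f(1)]] show ?thesis
        by (auto simp: total_on_def mor_into_iff)
    next
      case False
      then have "idx (Dom C f) \<noteq> idx (Dom C f')"
        using inj_onD[OF idx] Dom f by blast
      with f show ?thesis by auto
    qed
  qed
  ultimately show ?thesis by (auto simp: order_on_defs)
qed

text \<open>Ranks turn morphisms into positions. The strict inequality holds across blocks as well
  as inside one, as required for composition with \<open>g\<close> to be a subword
  inclusion.\<close>

lemma mor_into_rank:
  assumes "left_locally_totally_ordered C"
  obtains p :: "'a \<Rightarrow> 'b \<Rightarrow> nat"
  where "\<And>d. d \<in> Obj C \<Longrightarrow> bij_betw (p d) (mor_into d) {..<card (mor_into d)}"
    and "\<And>d e g f f'. \<lbrakk>g \<in> Hom C d e; f \<in> mor_into d; f' \<in> mor_into d; p d f < p d f'\<rbrakk>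
      \<Longrightarrow> p e (g \<cdot> f) < p e (g \<cdot> f')"
proof -
  obtain r where lin: "\<And>c d. \<lbrakk>c \<in> Obj C; d \<in> Obj C\<rbrakk> \<Longrightarrow> linear_order_on (Hom C c d) (r c d)"
    and left: "\<And>c d e f f' g. \<lbrakk>c \<in> Obj C; d \<in> Obj C; e \<in> Obj C; g \<in> Hom C d e;
      f \<in> Hom C c d; f' \<in> Hom C c d; (f, f') \<in> r c d - Id\<rbrakk>
      \<Longrightarrow> (g \<cdot>\<^bsub>C\<^esub> f, g \<cdot>\<^bsub>C\<^esub> f') \<in> r c e - Id"
    using assms unfolding left_locally_totally_ordered_def by blast
  \<comment> \<open>One numbering of the objects serves every \<open>d\<close>, so that the blocks
    come in the same order in all words.\<close>
  obtain idx :: "'a \<Rightarrow> nat" where idx: "inj_on idx (Obj C)"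
    using finite_imp_inj_to_nat_seg[OF finite_Obj] by blast
  define L where "L d = {(f, f'). f \<in> mor_into d \<and> f' \<in> mor_into d \<and>
    (idx (Dom C f) < idx (Dom C f') \<or> Dom C f = Dom C f' \<and> (f, f') \<in> r (Dom C f) d)}" for d
  define rank where "rank d p \<longleftrightarrow> bij_betw p (mor_into d) {..<card (mor_into d)} \<and>
    (\<forall>f\<in>mor_into d. \<forall>f'\<in>mor_into d. p f < p f' \<longleftrightarrow> (f, f') \<in> L d - Id)"
    for d and p :: "'b \<Rightarrow> nat"
  have "\<exists>p. rank d p" if d: "d \<in> Obj C" for d
  proof -
    have "linear_order_on (mor_into d) (L d)"
      unfolding L_def by (rule mor_into_order[OF _ idx]) (rule lin[OF _ d])
    then show ?thesis
      unfolding rank_def by (rule finite_linear_order_on_rank[OF finite_mor_into]) blast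
  qed
  then obtain p where "\<And>d. d \<in> Obj C \<Longrightarrow> rank d (p d)"
    by metis
  then have bij: "\<And>d. d \<in> Obj C \<Longrightarrow> bij_betw (p d) (mor_into d) {..<card (mor_into d)}"
    and p: "\<And>d f f'. \<lbrakk>d \<in> Obj C; f \<in> mor_into d; f' \<in> mor_into d\<rbrakk>
      \<Longrightarrow> p d f < p d f' \<longleftrightarrow> (f, f') \<in> L d - Id"
    unfolding rank_def by blast+
  have "p e (g \<cdot> f) < p e (g \<cdot> f')"
    if g: "g \<in> Hom C d e" and f: "f \<in> mor_into d" "f' \<in> mor_into d" and "p d f < p d f'"
    for d e g f f'
  proof -
    have obj: "d \<in> Obj C" "e \<in> Obj C" "Dom C f \<in> Obj C"
      using g f dom_in_Obj cod_in_Obj by (auto simp: Hom_def mor_into_def)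
    note gf = comp_in_mor_into[OF f(1) g] comp_in_mor_into[OF f(2) g]
    have "(f, f') \<in> L d - Id"
      using that p obj by blast
    \<comment> \<open>Composition with \<open>g\<close> keeps domains. Hence a comparison between
      blocks is unchanged, and one inside a block is handled by \<open>left\<close>.\<close>
    then have "(g \<cdot> f, g \<cdot> f') \<in> L e - Id"
      using left[OF obj(3,1,2) g, of f f'] f gf by (auto simp: L_def mor_into_iff)
    then show ?thesis
      using p[OF obj(2) gf(1,3)] by blast
  qed
  with bij that show thesis by blast
qed

section \<open>The words and position maps of the embedding\<close>

lemma weak_embedding_of_left_locally_totally_ordered:
  assumes acyclic: "acyclic_category C" and lto: "left_locally_totally_ordered C"
    and \<phi>: "inj_on (\<phi> :: 'a \<Rightarrow> 's) (Obj C)"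
  shows "\<exists>F\<^sub>o F\<^sub>m. weak_embedding C (Word (UNIV :: 's set)) F\<^sub>o F\<^sub>m"
proof -
  obtain p where bij: "\<And>d. d \<in> Obj C \<Longrightarrow> bij_betw (p d) (mor_into d) {..<card (mor_into d)}"
    and mono: "\<And>d e g f f'. \<lbrakk>g \<in> Hom C d e; f \<in> mor_into d; f' \<in> mor_into d; p d f < p d f'\<rbrakk>
      \<Longrightarrow> p e (g \<cdot> f) < p e (g \<cdot> f')"
    using mor_into_rank[OF lto] by blast
  \<comment> \<open>\<open>m d i\<close> is the morphism at position \<open>i\<close>. The map
    \<phi> encodes domains as letters, and \<open>G g\<close> decodes a position, composes with
    \<open>g\<close> and takes the rank again.\<close>
  define m where "m d i = inv_into (mor_into d) (p d) i" for d i
  define W where "W d = map (\<lambda>i. \<phi> (Dom C (m d i))) [0..<card (mor_into d)]" for d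
  define G where "G g = (\<lambda>i\<in>{..<card (mor_into (Dom C g))}. p (Cod C g) (g \<cdot> m (Dom C g) i))" for g
  have len: "length (W d) = card (mor_into d)" for d
    by (simp add: W_def)
  have m_in: "m d i \<in> mor_into d" and p_m: "p d (m d i) = i"
    if "d \<in> Obj C" "i < card (mor_into d)" for d i
    using bij[OF that(1)] that(2) unfolding m_def
    by (auto simp: bij_betw_def inv_into_into f_inv_into_f)
  have m_p: "m d (p d f) = f" and p_lt: "p d f < card (mor_into d)"
    if "d \<in> Obj C" "f \<in> mor_into d" for d f
    using bij[OF that(1)] that(2) unfolding m_def by (auto simp: bij_betw_def)
  have obj: "d \<in> Obj C" "e \<in> Obj C" "Dom C g = d" "Cod C g = e" if "g \<in> Hom C d e" for d e g
    using that dom_in_Obj cod_in_Obj by (auto simp: Hom_def)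
  have G: "G g i = p e (g \<cdot> m d i)" if "g \<in> Hom C d e" "i < card (mor_into d)" for d e g i
    using obj[OF that(1)] that(2) by (simp add: G_def)
  have ident: "Ident C d \<in> mor_into d" if "d \<in> Obj C" for d
    using ident_in_Hom[OF that] by (simp add: mor_into_def Hom_def)
  have G_sub: "subword_inclusion (W d) (W e) (G g)" if g: "g \<in> Hom C d e" for d e g
  proof (rule subword_inclusionI, unfold len)
    note o = obj[OF g]
    show "G g \<in> {..<card (mor_into d)} \<rightarrow>\<^sub>E {..<card (mor_into e)}"
      using p_lt[OF o(2) comp_in_mor_into(1)[OF m_in[OF o(1)] g]] o by (auto simp: G_def)
    show "G g i < G g j" if "i < j" "j < card (mor_into d)" for i j
      using that mono[OF g m_in[OF o(1), of i] m_in[OF o(1), of j]] p_m[OF o(1)] G[OF g] by simp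
    \<comment> \<open>The composite with \<open>g\<close> has the same domain, hence the same
      letter.\<close>
    show "W e ! G g i = W d ! i" if i: "i < card (mor_into d)" for i
      using comp_in_mor_into[OF m_in[OF o(1) i] g] i
      by (simp add: G[OF g i] W_def p_lt[OF o(2)] m_p[OF o(2)])
  qed
  have "weak_embedding C (Word UNIV) W (\<lambda>g. (W (Dom C g), W (Cod C g), G g))"
  proof (intro weak_embedding.intro category_functor.intro category_Word
      category_functor_axioms.intro weak_embedding_axioms.intro)
    show "category C" by unfold_locales
    show "W c \<in> Obj (Word UNIV)" for c by simp
    show "(W (Dom C f), W (Cod C f), G f) \<in> Hom (Word UNIV) (W c) (W d)"
      if "f \<in> Hom C c d" for f c d
      using G_sub[OF that] obj[OF that] by (simp add: Hom_Word)
    show "(W (Dom C (Ident C c)), W (Cod C (Ident C c)), G (Ident C c)) = Ident (Word UNIV) (W c)"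
      if c: "c \<in> Obj C" for c
    proof -
      note i = ident_in_Hom[OF c]
      have "Ident C c \<cdot> m c k = m c k" if "k < card (mor_into c)" for k
        using m_in[OF c that] comp_ident_left by (simp add: mor_into_iff)
      then show ?thesis
        using obj[OF i] p_m[OF c] by (auto simp: len G_def fun_eq_iff)
    qed
    show "(W (Dom C (g \<cdot> f)), W (Cod C (g \<cdot> f)), G (g \<cdot> f)) =
      (W (Dom C g), W (Cod C g), G g) \<cdot>\<^bsub>Word UNIV\<^esub> (W (Dom C f), W (Cod C f), G f)"
      if f: "f \<in> Hom C c d" and g: "g \<in> Hom C d e" for f c d g e
    proof -
      note gf = comp_in_Hom[OF f g]
      \<comment> \<open>This is associativity, read at the morphism in position
        \<open>k\<close>.\<close>
      have "G (g \<cdot> f) k = G g (G f k)" if k: "k < card (mor_into c)" for k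
      proof -
        note mk = m_in[OF obj(1)[OF f] k]
        note fm = comp_in_mor_into(1)[OF mk f]
        show ?thesis
          using comp_assoc[OF mk[unfolded mor_into_iff] f g]
          by (simp add: G[OF gf k] G[OF f k] G[OF g p_lt[OF obj(1)[OF g] fm]]
              m_p[OF obj(1)[OF g] fm])
      qed
      moreover have "G (g \<cdot> f) k = undefined" if "\<not> k < card (mor_into c)" for k
        using that obj[OF gf] by (simp add: G_def)
      ultimately show ?thesis
        using obj[OF f] obj[OF g] obj[OF gf] by (auto simp: len compose_def fun_eq_iff)
    qed
    show "inj_on (\<lambda>g. (W (Dom C g), W (Cod C g), G g)) (Hom C c d)"
      if c: "c \<in> Obj C" and d: "d \<in> Obj C" for c d
    proof (rule inj_on_inverseI)
      fix g assume g: "g \<in> Hom C c d"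
      \<comment> \<open>A left inverse as in the Yoneda lemma: the position map \<open>h\<close>
        sends the position of the identity to that of its composite with \<open>g\<close>, which is
        \<open>g\<close>, and \<open>m d\<close> decodes it.\<close>
      show "(\<lambda>(_, _, h). m d (h (p c (Ident C c)))) (W (Dom C g), W (Cod C g), G g) = g"
        using comp_in_mor_into(1)[OF ident[OF c] g] comp_ident_right[OF g]
        by (simp add: G[OF g p_lt[OF c ident[OF c]]] m_p[OF c ident[OF c]] m_p[OF d])
    qed
    show "inj_on W (Obj C)"
    proof -
      \<comment> \<open>The identity contributes the letter of \<open>c\<close> to
        \<open>W c\<close>, hence to \<open>W d\<close>, so some morphism into \<open>d\<close> has
        domain \<open>c\<close>. With the roles exchanged there is a morphism back, and acyclicity
        forces \<open>c = d\<close>.\<close>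
      have hom: "Hom C c d \<noteq> {}" if c: "c \<in> Obj C" and d: "d \<in> Obj C" and "W c = W d" for c d
      proof -
        have "set (W d) = \<phi> ` Dom C ` mor_into d" if "d \<in> Obj C" for d
        proof -
          have "mor_into d = m d ` {..<card (mor_into d)}"
            using m_in[OF that] m_p[OF that] p_lt[OF that] by force
          then show ?thesis
            unfolding W_def by (metis (no_types, lifting) atLeast_upt image_cong image_image list.set_map)
        qed
        then have "\<phi> (Dom C (Ident C c)) \<in> \<phi> ` Dom C ` mor_into d"
          using ident[OF c] c d \<open>W c = W d\<close> by (metis imageI)
        then obtain f where f: "f \<in> mor_into d" "\<phi> (Dom C f) = \<phi> c"
          using obj[OF ident_in_Hom[OF c]] by auto
        then have "Dom C f = c"
          using inj_onD[OF \<phi>] c dom_in_Obj by (auto simp: mor_into_def)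
        with f show ?thesis by (auto simp: mor_into_iff)
      qed
      then show ?thesis
        using acyclic unfolding acyclic_category_def inj_on_def by metis
    qed
  qed
  then show ?thesis by blast
qed

end

theorem theorem5p10:
  fixes C :: "('o, 'm) category_data"
  assumes "finite_category C" and "acyclic_category C"
  shows "(\<exists>(\<Sigma> :: 's::infinite set) F\<^sub>o F\<^sub>m. weak_embedding C (Word \<Sigma>) F\<^sub>o F\<^sub>m) \<longleftrightarrow>
    monic_category C \<and> left_locally_totally_ordered C"
proof
  interpret finite_category C by fact
  show "monic_category C \<and> left_locally_totally_ordered C"
    if "\<exists>(\<Sigma> :: 's set) F\<^sub>o F\<^sub>m. weak_embedding C (Word \<Sigma>) F\<^sub>o F\<^sub>m"
    using that left_locally_totally_ordered_of_weak_embedding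
      monic_of_left_locally_totally_ordered[OF category_axioms] by blast
  \<comment> \<open>The infinite type of letters has room for a distinct letter for each of the
    finitely many objects.\<close>
  obtain B :: "'s set" where "finite B" "card B = card (Obj C)"
    using infinite_arbitrarily_large[OF infinite_UNIV] by blast
  then obtain \<phi> :: "'o \<Rightarrow> 's" where "inj_on \<phi> (Obj C)"
    using card_le_inj[OF finite_Obj, of B] by auto
  then show "\<exists>(\<Sigma> :: 's set) F\<^sub>o F\<^sub>m. weak_embedding C (Word \<Sigma>) F\<^sub>o F\<^sub>m"
    if "monic_category C \<and> left_locally_totally_ordered C"
    using that weak_embedding_of_left_locally_totally_ordered[OF assms(2)] by blast
qed

end
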